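(* Let $T$ be a subset of $2^{\mathbb{N}}$ of cardinality $2^{\aleph_0}$. Then there exist a set $H\subseteq T\times 2^{\mathbb{N}}$ intersecting each vertical section $\{t\}\times 2^{\mathbb{N}}$, $t\in T$, in a singleton, and a homeomorphic copy $E$ of $H$ in $2^{\mathbb{N}}$ (i.e. a set $E\subseteq 2^{\mathbb{N}}$ homeomorphic to $H$) such that $E$ is not countably perfectly meager in $2^{\mathbb{N}}$. In particular, $T$ is a continuous injective image of $E$.
   Context: $2^{\mathbb{N}}$ is the Cantor space with the product topology; $H$ and $E$ carry the subspace topologies from $2^{\mathbb{N}}\times 2^{\mathbb{N}}$ and $2^{\mathbb{N}}$. A perfect set in a Polish space is a non-empty closed set with no isolated points. A perfect Polish space is a separable completely metrizable space with no isolated points. A subset $A$ of a perfect Polish space $X$ is countably perfectly meager in $X$ (a $\mathbf{PM}_\sigma$-set in $X$) if for every sequence $\{P_n : n\in\mathbb{N}\}$ of perfect subsets of $X$ there exists an $F_\sigma$-set $F$ in $X$ such that $A\subseteq F$ and $F\cap P_n$ is meager in $P_n$ for each $n$. *)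

theory Defs
  imports "HOL-Analysis.Analysis"
begin

definition nowhere_dense_in :: "'a topology \<Rightarrow> 'a set \<Rightarrow> bool" where
  "nowhere_dense_in X A \<longleftrightarrow> A \<subseteq> topspace X \<and> X interior_of (X closure_of A) = {}"

definition meager_in :: "'a topology \<Rightarrow> 'a set \<Rightarrow> bool" where
  "meager_in X = countable union_of nowhere_dense_in X"

definition no_isolated_points :: "'a topology \<Rightarrow> bool" where
  "no_isolated_points X \<longleftrightarrow> (\<forall>x\<in>topspace X. \<not> openin X {x})"

definition perfect_in :: "'a topology \<Rightarrow> 'a set \<Rightarrow> bool" where
  "perfect_in X P \<longleftrightarrow> closedin X P \<and> P \<noteq> {} \<and> no_isolated_points (subtopology X P)"

definition perfect_Polish_space :: "'a topology \<Rightarrow> bool" where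
  "perfect_Polish_space X \<longleftrightarrow>
     separable_space X \<and> completely_metrizable_space X \<and> no_isolated_points X"

text \<open>The notion below is meant for perfect Polish spaces X; that property is
  left out of the definition, so that a negated instance cannot hold merely because
  X fails to be such a space.\<close>

definition countably_perfectly_meager_in :: "'a topology \<Rightarrow> 'a set \<Rightarrow> bool" where
  "countably_perfectly_meager_in X A \<longleftrightarrow> A \<subseteq> topspace X \<and>
     (\<forall>P :: nat \<Rightarrow> 'a set. (\<forall>n. perfect_in X (P n)) \<longrightarrow>
        (\<exists>F. fsigma_in X F \<and> A \<subseteq> F \<and>
             (\<forall>n. meager_in (subtopology X (P n)) (F \<inter> P n))))"

text \<open>The Cantor space is the type of functions from nat to bool. Its class topology is the
  product of discrete topologies on bool.\<close>

abbreviation cantor_space :: "(nat \<Rightarrow> bool) topology" where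
  "cantor_space \<equiv> euclidean"

lemma cantor_space_eq:
  "cantor_space = product_topology (\<lambda>_. discrete_topology UNIV) UNIV"
proof -
  have "(euclidean :: bool topology) = discrete_topology UNIV"
    by (auto simp: topology_eq open_discrete)
  then show ?thesis
    by (metis euclidean_product_topology)
qed

lemma openin_cantor_spaceE:
  assumes "openin cantor_space V" "x \<in> V"
  obtains U where "finite {i. U i \<noteq> (UNIV :: bool set)}" "x \<in> Pi\<^sub>E UNIV U" "Pi\<^sub>E UNIV U \<subseteq> V"
proof -
  have "\<exists>U. finite {i \<in> UNIV. U i \<noteq> topspace (discrete_topology (UNIV :: bool set))} \<and>
      (\<forall>i\<in>UNIV. openin (discrete_topology UNIV) (U i)) \<and> x \<in> Pi\<^sub>E UNIV U \<and> Pi\<^sub>E UNIV U \<subseteq> V"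
    using assms unfolding cantor_space_eq openin_product_topology_alt by blast
  then show thesis
    using that by auto
qed

lemma perfect_Polish_space_cantor_space: "perfect_Polish_space cantor_space"
  unfolding perfect_Polish_space_def
proof (intro conjI)
  show "completely_metrizable_space cantor_space"
    unfolding cantor_space_eq
    by (simp add: completely_metrizable_space_product_topology
        completely_metrizable_space_discrete_topology)
  define D where "D = (\<lambda>A i. i \<in> A) ` {A :: nat set. finite A}"
  have "cantor_space closure_of D = UNIV"
  proof (rule equalityI[OF subset_UNIV], rule subsetI)
    fix x :: "nat \<Rightarrow> bool"
    have "\<exists>y\<in>D. y \<in> V" if V: "x \<in> V" "openin cantor_space V" for V
    proof -
      obtain U where U: "finite {i. U i \<noteq> (UNIV :: bool set)}" "x \<in> Pi\<^sub>E UNIV U"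
          "Pi\<^sub>E UNIV U \<subseteq> V"
        by (rule openin_cantor_spaceE[OF V(2,1)])
      define y where "y = (\<lambda>i. i \<in> {i. U i \<noteq> UNIV \<and> x i})"
      have "y \<in> D"
        unfolding D_def y_def by (intro imageI) (use U(1) in auto)
      moreover have "y i \<in> U i" for i
        using U(2) by (cases "U i = UNIV") (auto simp: y_def PiE_iff)
      ultimately show ?thesis
        using U(3) by (intro bexI[of _ y]) (auto intro!: subsetD[OF U(3)])
    qed
    then show "x \<in> cantor_space closure_of D"
      unfolding in_closure_of by auto
  qed
  moreover have "countable D"
    unfolding D_def by (intro countable_image countable_Collect_finite)
  ultimately show "separable_space cantor_space"
    unfolding separable_space_def by auto
  show "no_isolated_points cantor_space"
    unfolding no_isolated_points_def
  proof (intro ballI notI)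
    fix x :: "nat \<Rightarrow> bool"
    assume "openin cantor_space {x}"
    then obtain U where U: "finite {i. U i \<noteq> (UNIV :: bool set)}" "x \<in> Pi\<^sub>E UNIV U"
        "Pi\<^sub>E UNIV U \<subseteq> {x}"
      by (rule openin_cantor_spaceE) auto
    then obtain i where i: "U i = UNIV"
      using ex_new_if_finite[OF infinite_UNIV_nat U(1)] by auto
    have "x(i := \<not> x i) \<in> Pi\<^sub>E UNIV U"
      using U(2) i by (auto simp: PiE_iff)
    then have "x(i := \<not> x i) = x"
      using U(3) by blast
    then show False
      by (metis fun_upd_same)
  qed
qed

end

theory Submission
  imports Defs
begin

text \<open>
  It suffices to find a set \<open>E\<close> that is not countably perfectly meager and a continuous
  injection \<open>g\<close> of \<open>E\<close> onto \<open>T\<close>: the flipped graph \<open>{(g z, z) | z \<in> E}\<close> then serves as \<open>H\<close>,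
  being homeomorphic to \<open>E\<close> because \<open>g\<close> is continuous, with one point over each \<open>t \<in> T\<close> because
  \<open>g\<close> is bijective. The map \<open>g\<close> is the restriction of one fixed continuous map \<open>decode\<close> from a part
  of the Cantor space onto the whole Cantor space, and \<open>E\<close> selects one point \<open>e t\<close> from each fibre of \<open>decode\<close> over \<open>T\<close>.

  The map is designed so that each single fibre is already too large. Some positions of a
  sequence \<open>z\<close> are marked with pairs \<open>(n, b)\<close>, each pair occurring infinitely often, and infinitely
  many positions are unmarked. A true entry at a position marked \<open>(n, b)\<close> claims that coordinate
  \<open>n\<close> of the decoded point is \<open>b\<close>, and only the first claim about \<open>n\<close> counts. Decoding is
  continuous, since the first claim is visible in a finite prefix. However, a point of the fibre
  over \<open>t\<close> can postpone its remaining claims arbitrarily long and meanwhile do anything at the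
  unmarked positions. Hence the closure of a relatively open piece of the fibre, the points with a
  given prefix \<open>w\<close>, contains the perfect set \<open>silent w\<close> of all extensions of \<open>w\<close> that make no
  further claim (\<open>silent_subset_closure_fibre\<close>). This perfect set does not depend on \<open>t\<close>, so there
  are only countably many of them.

  The fibre is a G-delta set, so by the Baire category theorem, whenever an F-sigma set \<open>F\<close>
  contains it, one of the closed sets composing \<open>F\<close> contains such a relatively open piece and
  therefore some \<open>silent w\<close>; by Baire again \<open>F \<inter> silent w\<close> is not meager in \<open>silent w\<close>
  (\<open>fibre_fsigma_not_meager\<close>).

  Finally there are only continuum many F-sigma sets, so they can be indexed by the points of \<open>T\<close>,
  and \<open>e t\<close> is chosen in the fibre over \<open>t\<close> outside the set with index \<open>t\<close> whenever that is
  possible. An F-sigma set containing \<open>E\<close> must then contain the whole fibre over its own index, so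
  it is not meager in some \<open>silent w\<close>.
\<close>

section \<open>Finite approximations in the Cantor space\<close>

definition prefix :: "nat \<Rightarrow> (nat \<Rightarrow> bool) \<Rightarrow> bool list" where
  "prefix n z = map z [0..<n]"

lemma prefix_eq_iff: "prefix n y = prefix n z \<longleftrightarrow> (\<forall>i<n. y i = z i)"
  by (auto simp: prefix_def)

lemma prefix_eq_mono: "prefix n y = prefix n z \<Longrightarrow> m \<le> n \<Longrightarrow> prefix m y = prefix m z"
  by (auto simp: prefix_eq_iff)

lemma open_coordinate: "open {z :: nat \<Rightarrow> bool. z i = b}"
proof -
  have "open ((\<lambda>z :: nat \<Rightarrow> bool. z i) -` {b})"
    by (intro open_vimage continuous_on_product_coordinates) (rule open_discrete)
  then show ?thesis
    by (simp add: vimage_def)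
qed

lemma open_prefix: "open {z. prefix n z = w}"
proof (cases "length w = n")
  case True
  then have "{z. prefix n z = w} = (\<Inter>i<n. {z. z i = w ! i})"
    by (auto simp: prefix_def list_eq_iff_nth_eq)
  also have "open \<dots>"
    by (intro open_INT ballI open_coordinate) simp
  finally show ?thesis .
next
  case False
  then have "{z. prefix n z = w} = {}"
    by (auto simp: prefix_def)
  then show ?thesis
    by simp
qed

lemma open_cantor_iff:
  "open S \<longleftrightarrow> (\<forall>z\<in>S. \<exists>n. \<forall>y. prefix n y = prefix n z \<longrightarrow> y \<in> S)"
proof
  assume S: "open S"
  show "\<forall>z\<in>S. \<exists>n. \<forall>y. prefix n y = prefix n z \<longrightarrow> y \<in> S"
  proof
    fix z assume "z \<in> S"
    then obtain U where U: "finite {i. U i \<noteq> (UNIV :: bool set)}" "z \<in> Pi\<^sub>E UNIV U"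
        "Pi\<^sub>E UNIV U \<subseteq> S"
      using openin_cantor_spaceE[of S z] S by auto
    obtain n where n: "\<And>i. U i \<noteq> UNIV \<Longrightarrow> i < n"
      using U(1) unfolding finite_nat_set_iff_bounded by auto
    have "y \<in> S" if "prefix n y = prefix n z" for y
    proof -
      have "y i \<in> U i" for i
        using that n[of i] U(2) by (cases "U i = UNIV") (auto simp: prefix_eq_iff PiE_iff)
      then show ?thesis
        using U(3) by auto
    qed
    then show "\<exists>n. \<forall>y. prefix n y = prefix n z \<longrightarrow> y \<in> S"
      by blast
  qed
next
  assume *: "\<forall>z\<in>S. \<exists>n. \<forall>y. prefix n y = prefix n z \<longrightarrow> y \<in> S"
  show "open S"
  proof (subst open_subopen, intro ballI)
    fix z assume "z \<in> S"
    with * obtain n where "\<forall>y. prefix n y = prefix n z \<longrightarrow> y \<in> S"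
      by blast
    then show "\<exists>T. open T \<and> z \<in> T \<and> T \<subseteq> S"
      by (intro exI[of _ "{y. prefix n y = prefix n z}"]) (auto simp: open_prefix)
  qed
qed

lemma closed_cantor_iff:
  "closed S \<longleftrightarrow> (\<forall>z. (\<forall>n. \<exists>y\<in>S. prefix n y = prefix n z) \<longrightarrow> z \<in> S)"
proof -
  have "(z \<in> - S \<longrightarrow> (\<exists>n. \<forall>y. prefix n y = prefix n z \<longrightarrow> y \<in> - S)) \<longleftrightarrow>
      ((\<forall>n. \<exists>y\<in>S. prefix n y = prefix n z) \<longrightarrow> z \<in> S)" for z
    by auto
  then show ?thesis
    unfolding closed_def open_cantor_iff Ball_def by (simp only:)
qed

section \<open>A universal F-sigma set\<close>

text \<open>Read \<open>c\<close> as a list of forbidden cylinders: the \<open>m\<close>-th closed set consists of the points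
  none of whose prefixes \<open>w\<close> is forbidden by \<open>c\<close> at the code of \<open>(m, w)\<close>.\<close>

definition coded_fsigma :: "(nat \<Rightarrow> bool) \<Rightarrow> (nat \<Rightarrow> bool) set" where
  "coded_fsigma c = (\<Union>m. {z. \<forall>n. \<not> c (to_nat (m :: nat, prefix n z))})"

text \<open>A closed set is determined by the cylinders that miss it, and there are only countably many
  cylinders. This bounds the number of F-sigma sets by the continuum, in the form of a
  parametrization by the Cantor space, which is what the diagonal argument uses.\<close>

lemma fsigma_in_imp_coded:
  assumes "fsigma_in cantor_space F"
  obtains c where "F = coded_fsigma c"
proof -
  obtain C where C: "\<And>m :: nat. closed (C m)" "\<Union> (range C) = F"
    using assms unfolding fsigma_in_ascending by auto
  define c where "c k = (case from_nat k of (m, w) \<Rightarrow> \<forall>y\<in>C m. prefix (length w) y \<noteq> w)"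
    for k
  have "{z. \<forall>n. \<not> c (to_nat (m, prefix n z))} = C m" for m
  proof -
    have len: "length (prefix n z) = n" for n z
      by (simp add: prefix_def)
    have "z \<in> C m" if "\<forall>n. \<not> c (to_nat (m, prefix n z))" for z
    proof -
      have "\<forall>n. \<exists>y\<in>C m. prefix n y = prefix n z"
        using that by (auto simp: c_def len)
      then show ?thesis
        using C(1)[of m] unfolding closed_cantor_iff by blast
    qed
    then show ?thesis
      by (auto simp: c_def len)
  qed
  with C(2) have "F = coded_fsigma c"
    by (simp add: coded_fsigma_def)
  then show thesis
    by (rule that)
qed

section \<open>Baire category\<close>

lemma countable_closed_cover_interior:
  assumes "completely_metrizable_space X" "topspace X \<noteq> {}"
    and "countable \<C>" "\<And>C. C \<in> \<C> \<Longrightarrow> closedin X C" "topspace X \<subseteq> \<Union>\<C>"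
  obtains C where "C \<in> \<C>" "X interior_of C \<noteq> {}"
proof -
  have "\<Union>\<C> = topspace X"
    using assms(4,5) closedin_subset by fastforce
  then have "X interior_of \<Union>\<C> \<noteq> {}"
    using assms(2) by simp
  then show thesis
    using Baire_category_alt[of X \<C>] assms(1,3,4) that by blast
qed

lemma not_meager_in_topspace:
  assumes "completely_metrizable_space X" "topspace X \<noteq> {}"
  shows "\<not> meager_in X (topspace X)"
proof
  assume "meager_in X (topspace X)"
  then obtain \<U> where U: "countable \<U>" "\<And>A. A \<in> \<U> \<Longrightarrow> nowhere_dense_in X A" "\<Union>\<U> = topspace X"
    unfolding meager_in_def union_of_def by auto
  have "A \<subseteq> X closure_of A" if "A \<in> \<U>" for A
    using U(2)[OF that] by (intro closure_of_subset) (simp add: nowhere_dense_in_def)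
  then have "topspace X \<subseteq> \<Union> ((closure_of) X ` \<U>)"
    using U(3) by fastforce
  then obtain C where "C \<in> (closure_of) X ` \<U>" "X interior_of C \<noteq> {}"
    using U(1) by (elim countable_closed_cover_interior[OF assms, rotated -1]) auto
  with U(2) show False
    by (auto simp: nowhere_dense_in_def)
qed

section \<open>Decoding a point from a sequence of claims\<close>

text \<open>What matters is that each value is taken infinitely often. At the positions with value \<open>None\<close> a
  sequence may vary without making a claim.\<close>

definition marker :: "nat \<Rightarrow> (nat \<times> bool) option" where
  "marker i = from_nat (fst (prod_decode i))"

lemma marker_unbounded: "\<exists>i\<ge>n. marker i = v"
  by (rule exI[of _ "prod_encode (to_nat v, n)"]) (simp add: marker_def le_prod_encode_2)

text \<open>The points whose first claim about coordinate \<open>n\<close> is \<open>b\<close>: the witness \<open>i\<close> is any claim of \<open>b\<close>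
  that no contrary claim precedes, so the first claim agrees with it.\<close>

definition first_claim :: "nat \<Rightarrow> bool \<Rightarrow> (nat \<Rightarrow> bool) set" where
  "first_claim n b = {z. \<exists>i. marker i = Some (n, b) \<and> z i \<and>
     (\<forall>j<i. marker j = Some (n, \<not> b) \<longrightarrow> \<not> z j)}"

definition fibre :: "(nat \<Rightarrow> bool) \<Rightarrow> (nat \<Rightarrow> bool) set" where
  "fibre t = (\<Inter>n. first_claim n (t n))"

text \<open>Only meaningful on the union of the fibres: where \<open>z\<close> makes no claim about \<open>n\<close>, the value
  is an arbitrary \<open>False\<close>.\<close>

definition decode :: "(nat \<Rightarrow> bool) \<Rightarrow> nat \<Rightarrow> bool" where
  "decode z n \<longleftrightarrow> z \<in> first_claim n True"

lemma open_first_claim: "open (first_claim n b)"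
  unfolding open_cantor_iff
proof
  fix z assume "z \<in> first_claim n b"
  then obtain i where i: "marker i = Some (n, b)" "z i"
      "\<forall>j<i. marker j = Some (n, \<not> b) \<longrightarrow> \<not> z j"
    by (auto simp: first_claim_def)
  then have "\<forall>y. prefix (Suc i) y = prefix (Suc i) z \<longrightarrow> y \<in> first_claim n b"
    unfolding first_claim_def prefix_eq_iff by (auto intro!: exI[of _ i])
  then show "\<exists>m. \<forall>y. prefix m y = prefix m z \<longrightarrow> y \<in> first_claim n b"
    by blast
qed

lemma first_claim_unique: "z \<in> first_claim n b \<Longrightarrow> z \<in> first_claim n c \<Longrightarrow> b = c"
proof (rule ccontr)
  assume z: "z \<in> first_claim n b" "z \<in> first_claim n c" and "b \<noteq> c"
  then have c: "c = (\<not> b)"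
    by auto
  from z obtain i j where i: "marker i = Some (n, b)" "z i"
      "\<And>k. k < i \<Longrightarrow> marker k = Some (n, \<not> b) \<Longrightarrow> \<not> z k"
    and j: "marker j = Some (n, \<not> b)" "z j"
      "\<And>k. k < j \<Longrightarrow> marker k = Some (n, b) \<Longrightarrow> \<not> z k"
    unfolding first_claim_def c by auto
  have "i \<noteq> j"
    using i(1) j(1) by auto
  then show False
    using i j by (metis linorder_neqE_nat)
qed

lemma decode_fibre: "z \<in> fibre t \<Longrightarrow> decode z = t"
proof
  fix n assume "z \<in> fibre t"
  then have "z \<in> first_claim n (t n)"
    by (auto simp: fibre_def)
  then show "decode z n = t n"
    unfolding decode_def using first_claim_unique[of z n True "t n"] by (cases "t n") auto
qed

text \<open>Each coordinate of \<open>decode\<close> takes either value on a relatively open set: on the union of the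
  fibres the value \<open>False\<close> is witnessed by a claim too, not by the mere absence of one.\<close>

lemma continuous_on_decode: "continuous_on (\<Union>t. fibre t) decode"
proof (rule continuous_on_coordinatewise_then_product)
  fix n
  let ?G = "\<Union>t. fibre t"
  have val: "z \<in> first_claim n b \<longleftrightarrow> decode z n = b" if z: "z \<in> ?G" for z b
  proof -
    obtain t where "z \<in> fibre t"
      using z by blast
    then have "decode z = t" "z \<in> first_claim n (t n)"
      by (auto simp: decode_fibre fibre_def)
    then show ?thesis
      using first_claim_unique[of z n b "t n"] by auto
  qed
  show "continuous_on ?G (\<lambda>z. decode z n)"
    unfolding continuous_on_open_invariant
  proof (intro allI impI)
    fix B :: "bool set"
    have "open (\<Union>b\<in>B. first_claim n b)"
      by (intro open_UN ballI open_first_claim)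
    moreover have "(\<Union>b\<in>B. first_claim n b) \<inter> ?G = (\<lambda>z. decode z n) -` B \<inter> ?G"
    proof (rule set_eqI)
      fix z
      show "z \<in> (\<Union>b\<in>B. first_claim n b) \<inter> ?G \<longleftrightarrow> z \<in> (\<lambda>z. decode z n) -` B \<inter> ?G"
        using val[of z] by (cases "z \<in> ?G") simp_all
    qed
    ultimately show "\<exists>A. open A \<and> A \<inter> ?G = (\<lambda>z. decode z n) -` B \<inter> ?G"
      by (intro exI conjI)
  qed
qed

text \<open>The point over \<open>t\<close> that makes every true claim about \<open>t\<close> and no false one. Besides showing
  that fibres are nonempty, its tails can be grafted onto any prefix without contradicting \<open>t\<close>.\<close>

definition transcript :: "(nat \<Rightarrow> bool) \<Rightarrow> nat \<Rightarrow> bool" where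
  "transcript t i = (case marker i of None \<Rightarrow> False | Some (n, b) \<Rightarrow> t n = b)"

lemma transcript_in_fibre: "transcript t \<in> fibre t"
proof -
  have "transcript t \<in> first_claim n (t n)" for n
  proof -
    obtain i where "marker i = Some (n, t n)"
      using marker_unbounded by blast
    then show ?thesis
      by (auto simp: first_claim_def transcript_def intro!: exI[of _ i])
  qed
  then show ?thesis
    by (simp add: fibre_def)
qed

text \<open>A fibre is a countable intersection of open sets, so the Baire category theorem applies to it,
  although it is not closed.\<close>

lemma completely_metrizable_fibre:
  "completely_metrizable_space (subtopology cantor_space (fibre t))"
proof (rule completely_metrizable_space_gdelta_in)
  show "completely_metrizable_space cantor_space"
    using perfect_Polish_space_cantor_space by (simp add: perfect_Polish_space_def)
  show "gdelta_in cantor_space (fibre t)"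
    unfolding fibre_def by (intro gdelta_in_Inter) (auto intro!: open_imp_gdelta_in open_first_claim)
qed

section \<open>The perfect sets\<close>

definition silent :: "bool list \<Rightarrow> (nat \<Rightarrow> bool) set" where
  "silent w = {z. prefix (length w) z = w \<and> (\<forall>i\<ge>length w. marker i \<noteq> None \<longrightarrow> \<not> z i)}"

lemma closed_silent: "closed (silent w)"
proof -
  have "silent w = (\<Inter>v\<in>-{w}. - {z. prefix (length w) z = v}) \<inter>
      (\<Inter>i\<in>{i. length w \<le> i \<and> marker i \<noteq> None}. - {z. z i = True})"
    by (auto simp: silent_def)
  then show ?thesis
    by (simp only:) (intro closed_Int closed_INT ballI closed_Compl open_prefix open_coordinate)
qed

lemma silent_nonempty: "silent w \<noteq> {}"
proof -
  have "(\<lambda>i. i < length w \<and> w ! i) \<in> silent w"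
    by (auto simp: silent_def prefix_def intro!: nth_equalityI)
  then show ?thesis
    by blast
qed

text \<open>No point is isolated because flipping a late unmarked position creates no claim.\<close>

lemma perfect_silent: "perfect_in cantor_space (silent w)"
proof -
  have "\<not> openin (subtopology cantor_space (silent w)) {z}" if z: "z \<in> silent w" for z
  proof
    assume "openin (subtopology cantor_space (silent w)) {z}"
    then obtain V where V: "open V" "{z} = V \<inter> silent w"
      by (auto simp: openin_subtopology)
    then have "z \<in> V"
      by blast
    then obtain n where n: "\<And>y. prefix n y = prefix n z \<Longrightarrow> y \<in> V"
      using V(1) unfolding open_cantor_iff by blast
    obtain i where i: "i \<ge> max n (length w)" "marker i = None"
      using marker_unbounded by blast
    define y where "y = z(i := \<not> z i)"
    have "y \<in> V"
      using i(1) by (intro n) (auto simp: prefix_eq_iff y_def)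
    moreover have "prefix (length w) y = prefix (length w) z"
      using i(1) by (auto simp: prefix_eq_iff y_def)
    then have "y \<in> silent w"
      using z i(2) by (auto simp: silent_def y_def)
    ultimately have "y = z"
      using V(2) by blast
    then show False
      by (metis fun_upd_same y_def)
  qed
  then show ?thesis
    by (auto simp: perfect_in_def no_isolated_points_def closed_silent silent_nonempty)
qed

text \<open>Given \<open>y\<close> in the silent set, follow \<open>y\<close> for a long time and continue with the transcript of \<open>t\<close>.
  The claims of the common prefix with \<open>z\<close> are those of a point over \<open>t\<close>, the middle part makes
  none, and the transcript settles the coordinates that are still open in favour of \<open>t\<close>. So points
  over \<open>t\<close> approximate \<open>y\<close>.\<close>

lemma silent_subset_closure_fibre:
  assumes z: "z \<in> fibre t"
  shows "silent (prefix n z) \<subseteq> closure (fibre t \<inter> {x. prefix n x = prefix n z})"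
proof
  fix y assume "y \<in> silent (prefix n z)"
  then have yz: "prefix n y = prefix n z" and y: "\<And>i. n \<le> i \<Longrightarrow> marker i \<noteq> None \<Longrightarrow> \<not> y i"
    by (auto simp: silent_def prefix_def)
  let ?A = "fibre t \<inter> {x. prefix n x = prefix n z}"
  have "\<exists>x\<in>?A. prefix m x = prefix m y" for m
  proof -
    define l where "l = max m n"
    define x where "x i = (if i < l then y i else transcript t i)" for i
    have xy: "prefix l x = prefix l y"
      by (simp add: prefix_eq_iff x_def)
    have xz: "prefix n x = prefix n z"
      using prefix_eq_mono[OF xy, of n] yz by (simp add: l_def)
    have "x \<in> first_claim k (t k)" for k
    proof -
      obtain i where i: "marker i = Some (k, t k)" "z i"
          "\<And>j. j < i \<Longrightarrow> marker j = Some (k, \<not> t k) \<Longrightarrow> \<not> z j"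
        using z by (auto simp: fibre_def first_claim_def)
      \<comment> \<open>Coordinate \<open>k\<close> is either decided within the common prefix or left to the transcript.\<close>
      show ?thesis
      proof (cases "i < n")
        case True
        then show ?thesis
          using i xz by (auto simp: first_claim_def prefix_eq_iff intro!: exI[of _ i])
      next
        case False
        obtain i' where i': "i' \<ge> l" "marker i' = Some (k, t k)"
          using marker_unbounded by blast
        have "\<not> x j" if j: "marker j = Some (k, \<not> t k)" for j
        proof -
          consider "j < n" | "n \<le> j" "j < l" | "l \<le> j"
            by linarith
          then show ?thesis
          proof cases
            case 1
            then show ?thesis
              using i(3)[of j] j xz False by (auto simp: prefix_eq_iff)
          next
            case 2
            then show ?thesis
              using y[of j] j by (simp add: x_def)
          next
            case 3
            then show ?thesis
              using j by (simp add: x_def transcript_def)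
          qed
        qed
        moreover have "x i'"
          using i' by (simp add: x_def transcript_def)
        ultimately show ?thesis
          using i'(2) by (auto simp: first_claim_def)
      qed
    qed
    then have "x \<in> ?A"
      using xz by (simp add: fibre_def)
    then show ?thesis
      using prefix_eq_mono[OF xy, of m] by (auto simp: l_def)
  qed
  then have "\<forall>m. \<exists>x\<in>closure ?A. prefix m x = prefix m y"
    using closure_subset[of ?A] by (meson subsetD)
  then show "y \<in> closure ?A"
    using closed_closure[of ?A, unfolded closed_cantor_iff] by simp
qed

text \<open>Baire category is used twice: in the fibre, to find a closed part of \<open>F\<close> containing a
  relatively open piece and hence a silent set, and in that silent set, which is not meager in
  itself.\<close>

lemma fibre_fsigma_not_meager:
  assumes F: "fsigma_in cantor_space F" "fibre t \<subseteq> F"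
  obtains w where "\<not> meager_in (subtopology cantor_space (silent w)) (F \<inter> silent w)"
proof -
  obtain C where C: "\<And>m :: nat. closed (C m)" "\<Union> (range C) = F"
    using F(1) unfolding fsigma_in_ascending by auto
  let ?X = "subtopology cantor_space (fibre t)"
  obtain D where "D \<in> range (\<lambda>m. fibre t \<inter> C m)" "?X interior_of D \<noteq> {}"
  proof (rule countable_closed_cover_interior)
    show "completely_metrizable_space ?X"
      by (rule completely_metrizable_fibre)
    show "topspace ?X \<noteq> {}"
      using transcript_in_fibre by auto
    show "topspace ?X \<subseteq> \<Union> (range (\<lambda>m. fibre t \<inter> C m))"
      using F(2) C(2) by auto
    show "countable (range (\<lambda>m. fibre t \<inter> C m))"
      by simp
    show "closedin ?X D" if "D \<in> range (\<lambda>m. fibre t \<inter> C m)" for D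
      using that C(1) by (auto simp: closedin_subtopology_Int_closed)
  qed
  then obtain m z where "z \<in> ?X interior_of (fibre t \<inter> C m)"
    by blast
  then obtain V where V: "open V" "z \<in> V" "z \<in> fibre t" "V \<inter> fibre t \<subseteq> C m"
    unfolding interior_of_def openin_subtopology by auto
  then obtain n where n: "\<And>y. prefix n y = prefix n z \<Longrightarrow> y \<in> V"
    unfolding open_cantor_iff by blast
  let ?P = "silent (prefix n z)"
  have "?P \<subseteq> closure (fibre t \<inter> {x. prefix n x = prefix n z})"
    by (rule silent_subset_closure_fibre[OF V(3)])
  also have "\<dots> \<subseteq> C m"
    using n V(4) by (intro closure_minimal C(1)) auto
  finally have "F \<inter> ?P = topspace (subtopology cantor_space ?P)"
    using C(2) by auto
  moreover have "completely_metrizable_space (subtopology cantor_space ?P)"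
    using perfect_Polish_space_cantor_space closed_silent
    by (intro completely_metrizable_space_closedin) (auto simp: perfect_Polish_space_def)
  ultimately have "\<not> meager_in (subtopology cantor_space ?P) (F \<inter> ?P)"
    using not_meager_in_topspace[of "subtopology cantor_space ?P"] silent_nonempty by auto
  then show thesis
    by (rule that)
qed

section \<open>Diagonalising over the codes\<close>

text \<open>If \<open>F = coded_fsigma (h t)\<close> contains the transversal, then it contains \<open>e t\<close>. As \<open>e t\<close> avoids
  that set whenever the fibre over \<open>t\<close> allows it, the whole fibre lies in \<open>F\<close>, which makes \<open>F\<close> too
  large.\<close>

lemma not_countably_perfectly_meager_transversal:
  assumes "T \<approx> (UNIV :: (nat \<Rightarrow> bool) set)"
  obtains e where "\<And>t. t \<in> T \<Longrightarrow> e t \<in> fibre t"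
    "\<not> countably_perfectly_meager_in cantor_space (e ` T)"
proof -
  obtain h where h: "bij_betw h T (UNIV :: (nat \<Rightarrow> bool) set)"
    using assms unfolding eqpoll_def by blast
  define e where "e t =
    (if fibre t \<subseteq> coded_fsigma (h t) then transcript t
     else SOME z. z \<in> fibre t - coded_fsigma (h t))" for t
  have e: "e t \<in> fibre t \<and> (\<not> fibre t \<subseteq> coded_fsigma (h t) \<longrightarrow> e t \<notin> coded_fsigma (h t))" for t
  proof (cases "fibre t \<subseteq> coded_fsigma (h t)")
    case True
    then show ?thesis
      by (simp add: e_def transcript_in_fibre)
  next
    case False
    then have "\<exists>z. z \<in> fibre t - coded_fsigma (h t)"
      by blast
    then have "(SOME z. z \<in> fibre t - coded_fsigma (h t)) \<in> fibre t - coded_fsigma (h t)"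
      by (rule someI_ex)
    then show ?thesis
      using False by (simp add: e_def)
  qed
  have "\<not> countably_perfectly_meager_in cantor_space (e ` T)"
  proof
    let ?P = "\<lambda>n. silent (from_nat n)"
    assume "countably_perfectly_meager_in cantor_space (e ` T)"
    then have "(\<forall>n. perfect_in cantor_space (?P n)) \<longrightarrow>
        (\<exists>F. fsigma_in cantor_space F \<and> e ` T \<subseteq> F \<and>
          (\<forall>n. meager_in (subtopology cantor_space (?P n)) (F \<inter> ?P n)))"
      unfolding countably_perfectly_meager_in_def by (elim conjE) (erule spec)
    then obtain F where F: "fsigma_in cantor_space F" "e ` T \<subseteq> F"
        "\<forall>n. meager_in (subtopology cantor_space (?P n)) (F \<inter> ?P n)"
      using perfect_silent by (elim impE exE conjE) (rule allI)
    obtain c where c: "F = coded_fsigma c"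
      using fsigma_in_imp_coded[OF F(1)] .
    obtain t where t: "t \<in> T" "h t = c"
      using h unfolding bij_betw_def by (metis UNIV_I imageE)
    have "fibre t \<subseteq> F"
      using e[of t] t c F(2) by auto
    then obtain w where "\<not> meager_in (subtopology cantor_space (silent w)) (F \<inter> silent w)"
      by (rule fibre_fsigma_not_meager[OF F(1)])
    with F(3)[rule_format, of "to_nat w"] show False
      by simp
  qed
  with e show thesis
    by (intro that[of e]) simp_all
qed

theorem theorem1p1:
  fixes T :: "(nat \<Rightarrow> bool) set"
  assumes "T \<approx> (UNIV :: (nat \<Rightarrow> bool) set)"
  shows "\<exists>(H :: ((nat \<Rightarrow> bool) \<times> (nat \<Rightarrow> bool)) set) (E :: (nat \<Rightarrow> bool) set).
           H \<subseteq> T \<times> UNIV \<and>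
           (\<forall>t\<in>T. is_singleton (H \<inter> ({t} \<times> UNIV))) \<and>
           H homeomorphic E \<and>
           \<not> countably_perfectly_meager_in cantor_space E \<and>
           (\<exists>g :: (nat \<Rightarrow> bool) \<Rightarrow> (nat \<Rightarrow> bool).
              continuous_on E g \<and> inj_on g E \<and> g ` E = T)"
proof -
  obtain e where e: "\<And>t. t \<in> T \<Longrightarrow> e t \<in> fibre t"
      and E: "\<not> countably_perfectly_meager_in cantor_space (e ` T)"
    by (rule not_countably_perfectly_meager_transversal[OF assms]) blast
  \<comment> \<open>As \<open>decode\<close> inverts \<open>e\<close>, this is also the flipped graph of \<open>decode\<close> restricted to \<open>e ` T\<close>;
    so \<open>H\<close> is homeomorphic to \<open>e ` T\<close> by continuity of \<open>decode\<close>, for an arbitrary choice of \<open>e\<close>.\<close>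
  define H where "H = (\<lambda>t. (t, e t)) ` T"
  have dec: "decode (e t) = t" if "t \<in> T" for t
    using decode_fibre[OF e[OF that]] .
  have cont: "continuous_on (e ` T) decode"
    by (rule continuous_on_subset[OF continuous_on_decode]) (use e in auto)
  have "H \<inter> ({t} \<times> UNIV) = {(t, e t)}" if "t \<in> T" for t
    using that by (auto simp: H_def)
  then have sing: "\<forall>t\<in>T. is_singleton (H \<inter> ({t} \<times> UNIV))"
    by simp
  have "homeomorphism H (e ` T) snd (\<lambda>z. (decode z, z))"
  proof (rule homeomorphismI)
    show "continuous_on H snd"
      by (rule continuous_on_snd) (rule continuous_on_id)
    show "continuous_on (e ` T) (\<lambda>z. (decode z, z))"
      by (rule continuous_on_Pair[OF cont continuous_on_id])
  qed (auto simp: H_def dec)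
  then have hom: "H homeomorphic (e ` T)"
    unfolding homeomorphic_def by blast
  have "inj_on decode (e ` T)" "decode ` e ` T = T"
    using dec by (auto simp: inj_on_def image_image)
  moreover have "H \<subseteq> T \<times> UNIV"
    by (auto simp: H_def)
  ultimately show ?thesis
    using sing hom E cont by blast
qed

end
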